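(* Let $\mathbb{F}$ be a field, let $d=2$, and let $V$ be a vector space over $\mathbb{F}$ of dimension $d+1=3$. Let $\Phi = (A; \{E_i\}_{i=0}^2; A^*; \{E^*_i\}_{i=0}^2)$ be a Hessenberg system on $V$ with parameter array $(\{\theta_i\}_{i=0}^2; \{\theta^*_i\}_{i=0}^2; \{\phi_i\}_{i=1}^2)$, and let $\vartheta_i=\phi_i-(\theta^*_i-\theta^*_0)(\theta_{d-i+1}-\theta_0)$ for $1\le i\le 2$. Then the following are equivalent: (i) $E_0A^*E_2=0$; (ii) $E^*_0AE^*_2=0$; (iii) $\vartheta_1=\vartheta_2$; (iv) $\Phi$ is a Tridiagonal Hessenberg system (THS).
   Context: $\mathrm{End}(V)$ is the algebra of $\mathbb{F}$-linear maps $V\to V$. An element of $\mathrm{End}(V)$ is multiplicity-free if it is diagonalizable and every eigenspace has dimension one. For multiplicity-free $A$ with eigenspaces ordered $V_0,\dots,V_d$, the corresponding primitive idempotents are $E_0,\dots,E_d \in \mathrm{End}(V)$, where $E_i$ acts as the identity on $V_i$ and as $0$ on $V_j$ for $j\neq i$. The superscript $*$ in $A^*$, $E_i^*$, $\theta_i^*$ is just notation (not an adjoint). A Hessenberg system on $V$ is a sequence $\Phi=(A; \{E_i\}_{i=0}^d; A^*; \{E^*_i\}_{i=0}^d)$ of elements of $\mathrm{End}(V)$ such that: (i) $A$ and $A^*$ are multiplicity-free; (ii) $\{E_i\}_{i=0}^d$ is an ordering of the primitive idempotents of $A$; (iii) $\{E^*_i\}_{i=0}^d$ is an ordering of the primitive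 idempotents of $A^*$; (iv) for $0\le i,j\le d$, $E_iA^*E_j=0$ if $i-j>1$ and $E_iA^*E_j\neq 0$ if $i-j=1$; (v) for $0\le i,j\le d$, $E^*_iAE^*_j=0$ if $i-j>1$ and $E^*_iAE^*_j\neq 0$ if $i-j=1$. The parameter array of $\Phi$ is $(\{\theta_i\}_{i=0}^d; \{\theta^*_i\}_{i=0}^d; \{\phi_i\}_{i=1}^d)$, defined as follows. $\theta_i$ (resp. $\theta^*_i$) is the eigenvalue of $A$ (resp. $A^*$) on $E_iV$ (resp. $E^*_iV$). For $0\le i\le d$ put $U_i=(E^*_0V+\cdots+E^*_iV)\cap(E_0V+\cdots+E_{d-i}V)$; it is known that $\dim U_i=1$, $V=\bigoplus_{i=0}^d U_i$, $(A-\theta_{d-i}I)U_i=U_{i+1}$ $(0\le i\le d-1)$ and $(A^*-\theta^*_iI)U_i=U_{i-1}$ $(1\le i\le d)$. For $1\le i\le d$, $\phi_i$ is the unique nonzero scalar such that $(A-\theta_{d-i+1}I)(A^*-\theta^*_iI)$ acts on $U_i$ as $\phi_i I$. A Hessenberg system $\Phi$ is a Tridiagonal Hessenberg system (THS) if for all $0\le i,j\le d$ with $1<j-i$ we have both $E_iA^*E_j=0$ and $E^*_iAE^*_j=0$. *)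

theory Defs
  imports "HOL.Vector_Spaces"
begin

text \<open>The vector space \<open>V\<close> is the whole type \<open>'b\<close>, and an element of \<open>End(V)\<close> is a function
  \<open>'b \<Rightarrow> 'b\<close> that is linear with respect to \<open>scale\<close>. Sequences indexed by \<open>0, ..., d\<close> are functions
  on \<open>nat\<close> whose values beyond \<open>d\<close> are irrelevant. The variables \<open>Ad\<close>, \<open>Es\<close>, \<open>ths\<close> stand for \<open>A\<^sup>*\<close>, \<open>E\<^sup>*\<close>, \<open>\<theta>\<^sup>*\<close>.\<close>

context vector_space
begin

definition eigenspace :: "('b \<Rightarrow> 'b) \<Rightarrow> 'a \<Rightarrow> 'b set" where
  "eigenspace A t = {v. A v = t *s v}"

definition eigenvalue :: "('b \<Rightarrow> 'b) \<Rightarrow> 'a \<Rightarrow> bool" where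
  "eigenvalue A t \<longleftrightarrow> (\<exists>v. v \<noteq> 0 \<and> A v = t *s v)"

text \<open>Independence forces the vectors in \<open>B\<close> to be nonzero, so they are eigenvectors.\<close>

definition diagonalizable :: "('b \<Rightarrow> 'b) \<Rightarrow> bool" where
  "diagonalizable A \<longleftrightarrow>
     (\<exists>B. independent B \<and> span B = UNIV \<and> (\<forall>b\<in>B. \<exists>t. A b = t *s b))"

definition multiplicity_free :: "('b \<Rightarrow> 'b) \<Rightarrow> bool" where
  "multiplicity_free A \<longleftrightarrow>
     Vector_Spaces.linear scale scale A \<and> diagonalizable A \<and>
     (\<forall>t. eigenvalue A t \<longrightarrow> dim (eigenspace A t) = 1)"

definition primitive_idempotents :: "nat \<Rightarrow> ('b \<Rightarrow> 'b) \<Rightarrow> (nat \<Rightarrow> 'b \<Rightarrow> 'b) \<Rightarrow> bool" where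
  "primitive_idempotents d A E \<longleftrightarrow>
     (\<exists>th. bij_betw th {..d} {t. eigenvalue A t} \<and>
        (\<forall>i\<le>d. Vector_Spaces.linear scale scale (E i) \<and>
           (\<forall>j\<le>d. \<forall>v\<in>eigenspace A (th j). E i v = (if i = j then v else 0))))"

definition Hessenberg_system ::
  "nat \<Rightarrow> ('b \<Rightarrow> 'b) \<Rightarrow> (nat \<Rightarrow> 'b \<Rightarrow> 'b) \<Rightarrow> ('b \<Rightarrow> 'b) \<Rightarrow> (nat \<Rightarrow> 'b \<Rightarrow> 'b) \<Rightarrow> bool" where
  "Hessenberg_system d A E Ad Es \<longleftrightarrow>
     multiplicity_free A \<and> multiplicity_free Ad \<and>
     primitive_idempotents d A E \<and> primitive_idempotents d Ad Es \<and>
     (\<forall>i\<le>d. \<forall>j\<le>d.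
        (j + 1 < i \<longrightarrow> E i \<circ> Ad \<circ> E j = (\<lambda>_. 0)) \<and>
        (i = j + 1 \<longrightarrow> E i \<circ> Ad \<circ> E j \<noteq> (\<lambda>_. 0))) \<and>
     (\<forall>i\<le>d. \<forall>j\<le>d.
        (j + 1 < i \<longrightarrow> Es i \<circ> A \<circ> Es j = (\<lambda>_. 0)) \<and>
        (i = j + 1 \<longrightarrow> Es i \<circ> A \<circ> Es j \<noteq> (\<lambda>_. 0)))"

definition tridiagonal_Hessenberg_system ::
  "nat \<Rightarrow> ('b \<Rightarrow> 'b) \<Rightarrow> (nat \<Rightarrow> 'b \<Rightarrow> 'b) \<Rightarrow> ('b \<Rightarrow> 'b) \<Rightarrow> (nat \<Rightarrow> 'b \<Rightarrow> 'b) \<Rightarrow> bool" where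
  "tridiagonal_Hessenberg_system d A E Ad Es \<longleftrightarrow>
     Hessenberg_system d A E Ad Es \<and>
     (\<forall>i\<le>d. \<forall>j\<le>d. i + 1 < j \<longrightarrow>
        E i \<circ> Ad \<circ> E j = (\<lambda>_. 0) \<and> Es i \<circ> A \<circ> Es j = (\<lambda>_. 0))"

definition eigenvalue_on :: "('b \<Rightarrow> 'b) \<Rightarrow> 'b set \<Rightarrow> 'a" where
  "eigenvalue_on A W = (THE t. \<forall>w\<in>W. A w = t *s w)"

text \<open>The sum of subspaces \<open>E\<^sub>0V + \<dots> + E\<^sub>nV\<close>.\<close>

definition range_sum :: "(nat \<Rightarrow> 'b \<Rightarrow> 'b) \<Rightarrow> nat \<Rightarrow> 'b set" where
  "range_sum E n = {\<Sum>j\<le>n. w j | w. \<forall>j\<le>n. w j \<in> range (E j)}"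

definition split_space ::
  "nat \<Rightarrow> (nat \<Rightarrow> 'b \<Rightarrow> 'b) \<Rightarrow> (nat \<Rightarrow> 'b \<Rightarrow> 'b) \<Rightarrow> nat \<Rightarrow> 'b set" where
  "split_space d E Es i = range_sum Es i \<inter> range_sum E (d - i)"

definition shift :: "('b \<Rightarrow> 'b) \<Rightarrow> 'a \<Rightarrow> 'b \<Rightarrow> 'b" where
  "shift A t v = A v - t *s v"

definition parameter_array ::
  "nat \<Rightarrow> ('b \<Rightarrow> 'b) \<Rightarrow> (nat \<Rightarrow> 'b \<Rightarrow> 'b) \<Rightarrow> ('b \<Rightarrow> 'b) \<Rightarrow> (nat \<Rightarrow> 'b \<Rightarrow> 'b)
    \<Rightarrow> (nat \<Rightarrow> 'a) \<Rightarrow> (nat \<Rightarrow> 'a) \<Rightarrow> (nat \<Rightarrow> 'a) \<Rightarrow> bool" where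
  "parameter_array d A E Ad Es th ths ph \<longleftrightarrow>
     (\<forall>i\<le>d. th i = eigenvalue_on A (range (E i))) \<and>
     (\<forall>i\<le>d. ths i = eigenvalue_on Ad (range (Es i))) \<and>
     (\<forall>i\<in>{1..d}. ph i =
        (THE c. c \<noteq> 0 \<and>
           (\<forall>u\<in>split_space d E Es i.
              (shift A (th (d - i + 1)) \<circ> shift Ad (ths i)) u = c *s u)))"

end

end

theory Submission
  imports Defs
begin

text \<open>Let \<open>u\<^sub>0\<close> span \<open>E\<^sup>*\<^sub>0V\<close> and put \<open>u\<^sub>1 = (A - \<theta>\<^sub>2)u\<^sub>0\<close>, \<open>u\<^sub>2 = (A - \<theta>\<^sub>1)u\<^sub>1\<close>. In this basis
  \<open>A\<close> is lower bidiagonal with subdiagonal \<open>1, 1\<close> and \<open>A\<^sup>*\<close> is upper bidiagonal with superdiagonal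
  \<open>\<phi>\<^sub>1, \<phi>\<^sub>2\<close>. The range of \<open>E\<^sub>2\<close> is spanned by \<open>(\<theta>\<^sub>2-\<theta>\<^sub>1)(\<theta>\<^sub>2-\<theta>\<^sub>0)u\<^sub>0 + (\<theta>\<^sub>2-\<theta>\<^sub>0)u\<^sub>1 + u\<^sub>2\<close>,
  and \<open>E\<^sub>0 A = \<theta>\<^sub>0 E\<^sub>0\<close> determines \<open>E\<^sub>0u\<^sub>i\<close> from \<open>E\<^sub>0u\<^sub>0\<close>; so \<open>E\<^sub>0A\<^sup>*E\<^sub>2\<close> vanishes iff one scalar does, and that
  scalar is a nonzero multiple of \<open>\<vartheta>\<^sub>1 - \<vartheta>\<^sub>2\<close>. The basis \<open>u\<^sub>2, \<phi>\<^sub>2u\<^sub>1, \<phi>\<^sub>2\<phi>\<^sub>1u\<^sub>0\<close> has the same shape with the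
  roles of \<open>A\<close> and \<open>A\<^sup>*\<close> exchanged, which gives the same conclusion for \<open>E\<^sup>*\<^sub>0AE\<^sup>*\<^sub>2\<close>.\<close>

context vector_space
begin

lemma dim_one_multiple:
  assumes "dim S = 1" "v \<in> S" "v \<noteq> 0" "w \<in> S"
  shows "\<exists>c. w = c *s v"
proof -
  obtain B where B: "B \<subseteq> S" "S \<subseteq> span B" "card B = dim S"
    by (rule basis_exists[of S])
  then obtain b where "B = {b}"
    using assms(1) by (metis card_1_singletonE)
  with B assms have "v \<in> span {b}" "w \<in> span {b}" by blast+
  then obtain k l where k: "v = k *s b" "w = l *s b"
    unfolding span_singleton by blast
  with assms(3) have "w = (l / k) *s v" by auto
  then show ?thesis by blast
qed

end

section \<open>Spectral decomposition attached to an ordering of primitive idempotents\<close>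

locale spectral = vector_space scale + A: Vector_Spaces.linear scale scale A
  for scale :: "'a::field \<Rightarrow> 'b::ab_group_add \<Rightarrow> 'b" (infixr "*s" 75) and A :: "'b \<Rightarrow> 'b" +
  fixes d :: nat and E :: "nat \<Rightarrow> 'b \<Rightarrow> 'b" and t :: "nat \<Rightarrow> 'a"
  assumes linear_E: "i \<le> d \<Longrightarrow> Vector_Spaces.linear scale scale (E i)"
    and inj_t: "inj_on t {..d}"
    and A_E: "i \<le> d \<Longrightarrow> A (E i v) = t i *s E i v"
    and sum_E: "(\<Sum>i\<le>d. E i v) = v"
    and simple: "i \<le> d \<Longrightarrow> A v = t i *s v \<Longrightarrow> v \<noteq> 0 \<Longrightarrow> A w = t i *s w \<Longrightarrow> \<exists>c. w = c *s v"
    and E_eigenvector: "i \<le> d \<Longrightarrow> j \<le> d \<Longrightarrow> A v = t j *s v \<Longrightarrow> E i v = (if i = j then v else 0)"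
    and E_nonzero: "i \<le> d \<Longrightarrow> \<exists>v. E i v \<noteq> 0"
begin

lemma E_add: "i \<le> d \<Longrightarrow> E i (x + y) = E i x + E i y"
  and E_scale: "i \<le> d \<Longrightarrow> E i (c *s x) = c *s E i x"
  and E_diff: "i \<le> d \<Longrightarrow> E i (x - y) = E i x - E i y"
  and E_zero: "i \<le> d \<Longrightarrow> E i 0 = 0"
  and E_sum: "i \<le> d \<Longrightarrow> E i (sum f S) = (\<Sum>x\<in>S. E i (f x))"
  using Vector_Spaces.linear.axioms(3)[OF linear_E, of i]
  by (simp_all add: module_hom.add module_hom.scale module_hom.diff module_hom.zero module_hom.sum)

lemma t_eq_iff: "i \<le> d \<Longrightarrow> j \<le> d \<Longrightarrow> t i = t j \<longleftrightarrow> i = j"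
  using inj_t by (auto simp: inj_on_def)

lemma E_E: "i \<le> d \<Longrightarrow> j \<le> d \<Longrightarrow> E i (E j v) = (if i = j then E j v else 0)"
  by (rule E_eigenvector) (simp_all add: A_E)

text \<open>Expand \<open>v\<close> by \<open>sum_E\<close>: \<open>A\<close> scales each
  \<open>E j v\<close>, and \<open>E i\<close> keeps only the term with
  \<open>j = i\<close>.\<close>

lemma E_A:
  assumes "i \<le> d"
  shows "E i (A v) = t i *s E i v"
proof -
  have "E i (A v) = E i (A (\<Sum>j\<le>d. E j v))" by (simp add: sum_E)
  also have "\<dots> = (\<Sum>j\<le>d. if i = j then t i *s E i v else 0)"
    unfolding A.sum E_sum[OF assms]
    by (rule sum.cong) (use assms in \<open>auto simp: A_E E_scale E_E\<close>)
  also have "\<dots> = t i *s E i v" using assms by simp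
  finally show ?thesis .
qed

lemma E_multiple:
  assumes "i \<le> d" "E i v \<noteq> 0"
  shows "\<exists>c. E i w = c *s E i v"
  using assms by (intro simple[of i "E i v"]) (simp_all add: A_E)

lemma eigenvalue_on_range:
  assumes "i \<le> d"
  shows "eigenvalue_on A (range (E i)) = t i"
  unfolding eigenvalue_on_def
proof (rule the_equality)
  show "\<forall>w\<in>range (E i). A w = t i *s w" using assms by (auto simp: A_E)
next
  fix c assume "\<forall>w\<in>range (E i). A w = c *s w"
  moreover obtain v where "E i v \<noteq> 0" using E_nonzero assms by blast
  ultimately show "c = t i" using assms by (auto simp: A_E)
qed

text \<open>The components \<open>E i v\<close> add up to \<open>v\<close> and distinct idempotents
  annihilate each other, so a partial sum is cut out by the vanishing of the remaining components.
  This turns \<open>split_space\<close> into linear equations.\<close>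

lemma range_sum_eq:
  assumes "n \<le> d"
  shows "range_sum E n = {v. \<forall>i. n < i \<and> i \<le> d \<longrightarrow> E i v = 0}"
proof (intro set_eqI iffI)
  fix v assume "v \<in> range_sum E n"
  then obtain w where w: "v = (\<Sum>j\<le>n. w j)" "\<forall>j\<le>n. w j \<in> range (E j)"
    by (auto simp: range_sum_def)
  have "E i v = 0" if i: "n < i" "i \<le> d" for i
  proof -
    have "E i (w j) = 0" if "j \<le> n" for j
      using w(2) that i assms by (fastforce simp: E_E)
    then show ?thesis using i by (simp add: w(1) E_sum)
  qed
  then show "v \<in> {v. \<forall>i. n < i \<and> i \<le> d \<longrightarrow> E i v = 0}" by blast
next
  fix v assume v: "v \<in> {v. \<forall>i. n < i \<and> i \<le> d \<longrightarrow> E i v = 0}"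
  have "(\<Sum>j\<le>d. E j v) = (\<Sum>j\<le>n. E j v)"
    using assms v by (intro sum.mono_neutral_right) auto
  then have "v = (\<Sum>j\<le>n. E j v)" by (simp add: sum_E)
  then show "v \<in> range_sum E n" unfolding range_sum_def by blast
qed

end

text \<open>On a basis of eigenvectors \<open>sum_E\<close> and \<open>A_E\<close> are immediate;
  linearity carries them to the whole space.\<close>

lemma (in vector_space) spectral_exists:
  assumes mf: "multiplicity_free A" and pi: "primitive_idempotents d A E"
  shows "\<exists>t. spectral scale A d E t"
proof -
  obtain t where bij: "bij_betw t {..d} {x. eigenvalue A x}"
    and lin: "\<And>i. i \<le> d \<Longrightarrow> Vector_Spaces.linear scale scale (E i)"
    and E: "\<And>i j v. i \<le> d \<Longrightarrow> j \<le> d \<Longrightarrow> A v = t j *s v \<Longrightarrow> E i v = (if i = j then v else 0)"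
    using pi unfolding primitive_idempotents_def eigenspace_def by blast
  have linA: "Vector_Spaces.linear scale scale A"
    using mf by (simp add: multiplicity_free_def)
  interpret A: Vector_Spaces.linear scale scale A by (rule linA)
  obtain B where B: "independent B" "span B = UNIV" "\<forall>b\<in>B. \<exists>x. A b = x *s b"
    using mf by (auto simp: multiplicity_free_def diagonalizable_def)
  have ev: "\<exists>v. v \<noteq> 0 \<and> A v = t i *s v" if "i \<le> d" for i
    using bij_betwE[OF bij] that by (auto simp: eigenvalue_def)
  have basis: "\<exists>j\<le>d. A b = t j *s b" if b: "b \<in> B" for b
  proof -
    obtain x where x: "A b = x *s b" using B(3) b by blast
    have "b \<noteq> 0" using B(1) b dependent_zero by metis
    with x have "eigenvalue A x" unfolding eigenvalue_def by metis
    then have "x \<in> t ` {..d}" using bij_betw_imp_surj_on[OF bij] by simp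
    with x show ?thesis by blast
  qed
  have linE: "E i (c *s x) = c *s E i x" "E i (x + y) = E i x + E i y" "E i 0 = 0" if "i \<le> d" for i c x y
    using Vector_Spaces.linear.axioms(3)[OF lin[OF that]]
    by (simp_all add: module_hom.add module_hom.scale module_hom.zero)
  have both: "(\<Sum>i\<le>d. E i v) = v \<and> (\<forall>i\<le>d. A (E i v) = t i *s E i v)" for v
  proof -
    have "v \<in> span B" using B by simp
    then show ?thesis
    proof (induction rule: span_induct_alt)
      case base
      show ?case by (simp add: linE A.zero)
    next
      case (step c b y)
      obtain j where j: "j \<le> d" "A b = t j *s b" using basis step by blast
      have Eb: "E i b = (if i = j then b else 0)" if "i \<le> d" for i
        using E[OF that j] .
      have "(\<Sum>i\<le>d. E i b) = (\<Sum>i\<le>d. if i = j then b else 0)"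
        by (intro sum.cong) (simp_all add: Eb)
      also have "\<dots> = b" using j by simp
      finally have "(\<Sum>i\<le>d. E i b) = b" .
      then show ?case
        using step j
        by (auto simp: linE sum.distrib Eb A.add A.scale scale_right_distrib
            simp flip: scale_sum_right)
    qed
  qed
  have "spectral scale A d E t"
  proof unfold_locales
    fix i v w
    assume i: "i \<le> d" and v: "A v = t i *s v" "v \<noteq> 0" "A w = t i *s w"
    have "dim (eigenspace A (t i)) = 1"
      using mf v by (auto simp: multiplicity_free_def eigenvalue_def)
    then show "\<exists>c. w = c *s v"
      using v by (intro dim_one_multiple[of "eigenspace A (t i)"]) (auto simp: eigenspace_def)
  next
    fix i assume "i \<le> d"
    then show "\<exists>v. E i v \<noteq> 0" using ev E by metis
  qed (use linE bij both E in \<open>auto simp: bij_betw_def\<close>)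
  then show ?thesis by blast
qed

section \<open>Vanishing of the corner for three idempotents\<close>

locale spectral3 = spectral scale A 2 E t
  for scale :: "'a::field \<Rightarrow> 'b::ab_group_add \<Rightarrow> 'b" (infixr "*s" 75) and A E t
begin

lemma decompose: "E 0 v + E 1 v + E 2 v = v"
proof -
  have "{..2::nat} = {0, 1, 2}" by auto
  then show ?thesis using sum_E[of v] by (simp add: add.assoc)
qed

lemma t_distinct: "t 0 \<noteq> t 1" "t 0 \<noteq> t 2" "t 1 \<noteq> t 2"
  using t_eq_iff[of 0 1] t_eq_iff[of 0 2] t_eq_iff[of 1 2] by auto

text \<open>Formulated for any vectors on which the two maps act bidiagonally, so that it applies
  once to \<open>A\<close>, \<open>Ad\<close> and once with their roles exchanged.\<close>

lemma corner_zero_iff: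
  assumes lin: "Vector_Spaces.linear scale scale Ad"
    and A: "A u0 = t 2 *s u0 + u1" "A u1 = t 1 *s u1 + u2" "A u2 = t 0 *s u2"
    and Ad: "Ad u0 = s 0 *s u0" "Ad u1 = s 1 *s u1 + p1 *s u0" "Ad u2 = s 2 *s u2 + p2 *s u1"
    and nz: "u2 \<noteq> 0" "E 2 u0 \<noteq> 0"
  shows "E 0 \<circ> Ad \<circ> E 2 = (\<lambda>_. 0) \<longleftrightarrow>
    p1 - (s 1 - s 0) * (t 2 - t 0) = p2 - (s (2::nat) - s 0) * (t 1 - t 0)"
proof -
  interpret Ad: Vector_Spaces.linear scale scale Ad by (rule lin)
  \<comment> \<open>The coefficients come from solving \<open>A w = t 2 *s w\<close> with
    coefficient 1 at \<open>u2\<close>.\<close>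
  define w where "w = ((t 2 - t 1) * (t 2 - t 0)) *s u0 + (t 2 - t 0) *s u1 + u2"
  have u1: "u1 = A u0 - t 2 *s u0" and u2: "u2 = A u1 - t 1 *s u1" using A by simp_all
  \<comment> \<open>\<open>E 0\<close> turns \<open>A - t 2\<close> into the scalar
    \<open>t 0 - t 2\<close>; below, \<open>E 2\<close> turns it into zero.\<close>
  have E0u1: "E 0 u1 = (t 0 - t 2) *s E 0 u0"
    by (simp add: u1 E_A E_diff E_scale flip: scale_left_diff_distrib)
  have "E 0 u2 = (t 0 - t 1) *s E 0 u1"
    by (simp add: u2 E_A E_diff E_scale flip: scale_left_diff_distrib)
  with E0u1 have E0: "E 0 u1 = (t 0 - t 2) *s E 0 u0"
    "E 0 u2 = ((t 0 - t 1) * (t 0 - t 2)) *s E 0 u0" by simp_all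
  have E2u1: "E 2 u1 = 0" by (simp add: u1 E_A E_diff E_scale)
  then have E2u2: "E 2 u2 = 0" by (simp add: u2 E_A E_diff E_scale)
  have E0u2: "E 0 u2 = u2" using E_eigenvector[of 0 0] A by simp
  \<comment> \<open>\<open>u2 = E 0 u2\<close> is a nonzero vector and a multiple of
    \<open>E 0 u0\<close>.\<close>
  then have E0u0: "E 0 u0 \<noteq> 0" using E0 nz by auto
  have "A w = ((t 2 - t 1) * (t 2 - t 0)) *s A u0 + (t 2 - t 0) *s A u1 + A u2"
    by (simp add: w_def A.add A.scale)
  then have Aw: "A w = t 2 *s w"
    unfolding w_def A by (simp add: algebra_simps)
  have "E 2 w = ((t 2 - t 1) * (t 2 - t 0)) *s E 2 u0"
    by (simp add: w_def E_add E_scale E2u1 E2u2)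
  then have w: "w \<noteq> 0" using nz t_distinct E_zero[of 2] by auto
  have "E 0 (Ad w) = ((t 2 - t 1) * (t 2 - t 0) * s 0
      + (t 2 - t 0) * (s 1 * (t 0 - t 2) + p1)
      + (s 2 * ((t 0 - t 1) * (t 0 - t 2)) + p2 * (t 0 - t 2))) *s E 0 u0"
    by (simp add: w_def Ad.add Ad.scale Ad E_add E_scale E0 scale_right_distrib scale_left_distrib
        distrib_left mult.assoc)
  \<comment> \<open>The factor \<open>t 2 - t 0\<close> is nonzero; the other factor is the
    difference of the two sides of the claim.\<close>
  also have "(t 2 - t 1) * (t 2 - t 0) * s 0 + (t 2 - t 0) * (s 1 * (t 0 - t 2) + p1)
      + (s 2 * ((t 0 - t 1) * (t 0 - t 2)) + p2 * (t 0 - t 2))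
    = (t 2 - t 0) * ((p1 - (s 1 - s 0) * (t 2 - t 0)) - (p2 - (s 2 - s 0) * (t 1 - t 0)))"
    by algebra
  finally have key: "E 0 (Ad w) = 0 \<longleftrightarrow>
      p1 - (s 1 - s 0) * (t 2 - t 0) = p2 - (s 2 - s 0) * (t 1 - t 0)"
    using E0u0 t_distinct by simp
  \<comment> \<open>The range of \<open>E 2\<close> is the line through \<open>w\<close>, so the
    composite vanishes iff it does at \<open>w\<close>.\<close>
  have "E 0 \<circ> Ad \<circ> E 2 = (\<lambda>_. 0) \<longleftrightarrow> E 0 (Ad w) = 0"
  proof
    assume "E 0 \<circ> Ad \<circ> E 2 = (\<lambda>_. 0)"
    then have "E 0 (Ad (E 2 w)) = 0" by (metis comp_apply)
    then show "E 0 (Ad w) = 0" using E_eigenvector[of 2 2 w] Aw by simp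
  next
    assume z: "E 0 (Ad w) = 0"
    have "E 0 (Ad (E 2 v)) = 0" for v
    proof -
      obtain c where "E 2 v = c *s w"
        using simple[of 2 w "E 2 v"] Aw w by (auto simp: A_E)
      then show ?thesis using z by (simp add: Ad.scale E_scale)
    qed
    then show "E 0 \<circ> Ad \<circ> E 2 = (\<lambda>_. 0)" by (simp add: fun_eq_iff)
  qed
  with key show ?thesis by simp
qed

end

section \<open>The split basis of a Hessenberg system with three idempotents\<close>

locale hessenberg3 = vector_space scale + P: spectral3 scale A E t + Q: spectral3 scale Ad Es s
  for scale :: "'a::field \<Rightarrow> 'b::ab_group_add \<Rightarrow> 'b" (infixr "*s" 75) and A E t Ad Es s +
  assumes E20: "E 2 (Ad (E 0 v)) = 0"
    and E10: "\<exists>v. E 1 (Ad (E 0 v)) \<noteq> 0"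
    and E21: "\<exists>v. E 2 (Ad (E 1 v)) \<noteq> 0"
    and Es20: "Es 2 (A (Es 0 v)) = 0"
    and Es10: "\<exists>v. Es 1 (A (Es 0 v)) \<noteq> 0"
    and Es21: "\<exists>v. Es 2 (A (Es 1 v)) \<noteq> 0"
begin

text \<open>The conditions on \<open>Es\<close> make the \<open>Es\<close>-components of
  \<open>u0\<close>, \<open>u1\<close>, \<open>u2\<close> triangular with nonzero diagonal, so these
  vectors span. \<open>E20\<close> then gives the shape of \<open>Ad u2\<close>, while
  \<open>E10\<close> and \<open>E21\<close> force \<open>p2\<close> and \<open>p1\<close> to be
  nonzero.\<close>

lemma split_basis:
  obtains u0 u1 u2 p1 p2
  where "A u0 = t 2 *s u0 + u1" "A u1 = t 1 *s u1 + u2" "A u2 = t 0 *s u2"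
    "Ad u0 = s 0 *s u0" "Ad u1 = s 1 *s u1 + p1 *s u0" "Ad u2 = s 2 *s u2 + p2 *s u1"
    "u0 \<noteq> 0" "u1 \<noteq> 0" "u2 \<noteq> 0" "E 2 u0 \<noteq> 0" "Es 2 u2 \<noteq> 0" "p1 \<noteq> 0" "p2 \<noteq> 0"
    "split_space 2 E Es 1 = span {u1}"
    "split_space 2 E Es 2 = span {u2}"
proof -
  note [simp del] = One_nat_def
  note Esimps = P.E_add P.E_scale P.E_diff P.E_zero P.E_A P.E_E P.A_E
    Q.E_add Q.E_scale Q.E_diff Q.E_zero Q.E_A Q.E_E Q.A_E
  obtain y where y: "Es 1 (A (Es 0 y)) \<noteq> 0" using Es10 by blast
  define u0 u1 u2 where "u0 = Es 0 y" and "u1 = A u0 - t 2 *s u0" and "u2 = A u1 - t 1 *s u1"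
  have u0: "Es 1 u0 = 0" "Es 2 u0 = 0" "Es 0 u0 = u0" "u0 \<noteq> 0"
    using y by (auto simp: u0_def Esimps P.A.zero)
  have u1: "Es 2 u1 = 0" "Es 1 u1 \<noteq> 0" "E 2 u1 = 0"
    using y u0 Es20[of y] by (auto simp: u1_def Esimps simp flip: u0_def)
  \<comment> \<open>By \<open>Es20\<close> only the \<open>Es 1\<close> component of
    \<open>u1\<close> matters here; it spans the line on which \<open>Es21\<close> guarantees a
    nonzero value.\<close>
  have "Es 2 (A u1) = Es 2 (A (Es 0 u1 + Es 1 u1 + Es 2 u1))" by (simp only: Q.decompose)
  also have "\<dots> = Es 2 (A (Es 1 u1))" by (simp add: u1 Es20 P.A.add Esimps)
  finally have *: "Es 2 (A u1) = Es 2 (A (Es 1 u1))" .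
  obtain x where x: "Es 2 (A (Es 1 x)) \<noteq> 0" using Es21 by blast
  obtain c where "Es 1 x = c *s Es 1 u1" using Q.E_multiple[of 1 u1 x] u1 by auto
  with x have "Es 2 (A (Es 1 u1)) \<noteq> 0" by (auto simp: P.A.scale Esimps)
  with * u1 have u2: "Es 2 u2 \<noteq> 0" by (simp add: u2_def Esimps)
  \<comment> \<open>\<open>E 1\<close> kills the image of \<open>A - t 1\<close>, and
    \<open>E 2\<close> already kills \<open>u1\<close>; hence \<open>u2\<close> lies in the range of
    \<open>E 0\<close>.\<close>
  have Eu2: "E 1 u2 = 0" "E 2 u2 = 0" using u1 by (simp_all add: u2_def Esimps)
  have E0u2: "E 0 u2 = u2" using P.decompose[of u2] Eu2 by simp
  then have Au2: "A u2 = t 0 *s u2" by (metis P.A_E le0)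
  have u2nz: "u2 \<noteq> 0" using u2 by (auto simp: Esimps)
  \<comment> \<open>Elimination: clear the \<open>Es 2\<close> component with \<open>u2\<close>,
    then the \<open>Es 1\<close> component with \<open>u1\<close>; the rest is a multiple of
    \<open>u0\<close>.\<close>
  have span: "\<exists>a b c. v = a *s u0 + b *s u1 + c *s u2" for v
  proof -
    obtain c where c: "Es 2 v = c *s Es 2 u2" using Q.E_multiple[of 2 u2 v] u2 by auto
    define v' where "v' = v - c *s u2"
    have v': "Es 2 v' = 0" by (simp add: v'_def c Esimps)
    obtain b where b: "Es 1 v' = b *s Es 1 u1" using Q.E_multiple[of 1 u1 v'] u1 by auto
    define v'' where "v'' = v' - b *s u1"
    have v'': "Es 2 v'' = 0" "Es 1 v'' = 0" by (simp_all add: v''_def b v' u1 Esimps)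
    then have "Es 0 v'' = v''" using Q.decompose[of v''] by simp
    then obtain a where "v'' = a *s u0" using Q.E_multiple[of 0 u0 v''] u0 by auto
    then have "v = a *s u0 + b *s u1 + c *s u2" by (simp add: v''_def v'_def algebra_simps)
    then show ?thesis by blast
  qed
  \<comment> \<open>Otherwise \<open>E 2\<close> would vanish on all three spanning vectors.\<close>
  have E2u0: "E 2 u0 \<noteq> 0"
  proof
    assume "E 2 u0 = 0"
    then have "E 2 v = 0" for v
      using span[of v] u1 Eu2 by (auto simp: Esimps)
    then show False using P.E_nonzero[of 2] by simp
  qed
  have mult_u0: "\<exists>a. v = a *s u0" if "Es 1 v = 0" "Es 2 v = 0" for v
  proof -
    have "Es 0 v = v" using Q.decompose[of v] that by simp
    then show ?thesis using Q.E_multiple[of 0 u0 v] u0 by auto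
  qed
  have mult_u1: "\<exists>b. v = b *s u1" if v: "Es 2 v = 0" "E 2 v = 0" for v
  proof -
    obtain a b c where abc: "v = a *s u0 + b *s u1 + c *s u2" using span by blast
    have "c = 0" using v(1) u0 u1 u2 by (simp add: abc Esimps)
    moreover have "a = 0" using v(2) u1 Eu2 E2u0 by (simp add: abc Esimps)
    ultimately show ?thesis using abc by auto
  qed
  have mult_u2: "\<exists>c. v = c *s u2" if "E 1 v = 0" "E 2 v = 0" for v
  proof -
    have "E 0 v = v" using P.decompose[of v] that by simp
    then show ?thesis using P.E_multiple[of 0 u2 v] E0u2 u2nz by auto
  qed
  have Adu0: "Ad u0 = s 0 *s u0" by (simp add: u0_def Esimps)
  obtain p1 where p1: "Ad u1 - s 1 *s u1 = p1 *s u0"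
    using mult_u0[of "Ad u1 - s 1 *s u1"] u1 by (auto simp: Esimps)
  \<comment> \<open>Thus \<open>(Ad - s 2) u2\<close> has neither an \<open>Es 2\<close> nor an
    \<open>E 2\<close> component, which leaves only the line of \<open>u1\<close>.\<close>
  have "E 2 (Ad u2) = 0" using E20[of u2] E0u2 by simp
  then obtain p2 where p2: "Ad u2 - s 2 *s u2 = p2 *s u1"
    using mult_u1[of "Ad u2 - s 2 *s u2"] Eu2 by (auto simp: Esimps)
  have Ad1: "Ad u1 = s 1 *s u1 + p1 *s u0" and Ad2: "Ad u2 = s 2 *s u2 + p2 *s u1"
    using p1 p2 by (simp_all add: algebra_simps)
  \<comment> \<open>With \<open>p2 = 0\<close>, \<open>Ad\<close> would preserve the line of
    \<open>u2\<close>, which is the range of \<open>E 0\<close>, against \<open>E10\<close>.\<close>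
  have "p2 \<noteq> 0"
  proof
    assume p: "p2 = 0"
    obtain v where v: "E 1 (Ad (E 0 v)) \<noteq> 0" using E10 by blast
    obtain c where "E 0 v = c *s u2" using P.E_multiple[of 0 u2 v] E0u2 u2nz by auto
    then have "E 1 (Ad (E 0 v)) = 0" by (simp add: Q.A.scale Esimps Ad2 p Eu2)
    with v show False by simp
  qed
  \<comment> \<open>With \<open>p1 = 0\<close>, \<open>E 2 (Ad u1) = 0\<close>. By
    \<open>E20\<close> this value comes from \<open>E 1 u1\<close> alone, which spans the range of
    \<open>E 1\<close>, against \<open>E21\<close>.\<close>
  moreover have "p1 \<noteq> 0"
  proof
    assume p: "p1 = 0"
    obtain v where v: "E 2 (Ad (E 1 v)) \<noteq> 0" using E21 by blast
    \<comment> \<open>Otherwise \<open>u1\<close> is a multiple of \<open>u2\<close>, but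
      \<open>Es 2\<close> kills \<open>u1\<close> and not \<open>u2\<close>.\<close>
    have "E 1 u1 \<noteq> 0"
    proof
      assume "E 1 u1 = 0"
      then obtain c where "u1 = c *s u2" using mult_u2 u1 by blast
      then have "c *s Es 2 u2 = 0" "u1 \<noteq> 0" using u1 by (auto simp: Esimps)
      then show False using u2 \<open>u1 = c *s u2\<close> by auto
    qed
    then obtain c where c: "E 1 v = c *s E 1 u1" using P.E_multiple[of 1 u1 v] by auto
    have "E 2 (Ad u1) = E 2 (Ad (E 0 u1 + E 1 u1 + E 2 u1))" by (simp only: P.decompose)
    also have "\<dots> = E 2 (Ad (E 1 u1))" by (simp add: u1 E20 Q.A.add Esimps)
    finally have "E 2 (Ad (E 1 u1)) = 0" by (simp add: Ad1 p u1 Esimps)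
    with c v show False by (simp add: Q.A.scale Esimps)
  qed
  moreover have "u1 \<noteq> 0" using u1 by (auto simp: Esimps)
  moreover have "split_space 2 E Es 1 = span {u1}"
  proof -
    have "Suc 0 < i \<and> i \<le> 2 \<longleftrightarrow> i = 2" for i :: nat by auto
    then have "v \<in> split_space 2 E Es 1 \<longleftrightarrow> Es 2 v = 0 \<and> E 2 v = 0" for v
      by (simp add: split_space_def P.range_sum_eq Q.range_sum_eq One_nat_def)
    then show ?thesis using mult_u1 u1 by (fastforce simp: span_singleton Esimps)
  qed
  moreover have "split_space 2 E Es 2 = span {u2}"
  proof -
    have "0 < i \<and> i \<le> 2 \<longleftrightarrow> i = 1 \<or> i = 2" for i :: nat by auto
    moreover have "range_sum Es 2 = UNIV" by (auto simp: Q.range_sum_eq)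
    ultimately have "v \<in> split_space 2 E Es 2 \<longleftrightarrow> E 1 v = 0 \<and> E 2 v = 0" for v
      by (simp add: split_space_def P.range_sum_eq imp_disjL all_conj_distrib)
    then show ?thesis using mult_u2 Eu2 by (fastforce simp: span_singleton Esimps)
  qed
  moreover have "A u0 = t 2 *s u0 + u1" "A u1 = t 1 *s u1 + u2"
    by (simp_all add: u1_def u2_def)
  ultimately show ?thesis
    using that[of u0 u1 u2 p1 p2] Au2 Adu0 Ad1 Ad2 u0 u2 u2nz E2u0 by blast
qed

section \<open>The two corners in terms of the parameter array\<close>

lemma corners:
  assumes pa: "parameter_array 2 A E Ad Es th ths ph"
    and vth: "\<forall>i\<in>{1..2}. vth i = ph i - (ths i - ths 0) * (th (2 - i + 1) - th 0)"
  shows "E 0 \<circ> Ad \<circ> E 2 = (\<lambda>_. 0) \<longleftrightarrow> vth 1 = vth 2" (is ?E)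
    and "Es 0 \<circ> A \<circ> Es 2 = (\<lambda>_. 0) \<longleftrightarrow> vth 1 = vth 2" (is ?Es)
proof -
  obtain u0 u1 u2 p1 p2
    where A: "A u0 = t 2 *s u0 + u1" "A u1 = t 1 *s u1 + u2" "A u2 = t 0 *s u2"
      and Ad: "Ad u0 = s 0 *s u0" "Ad u1 = s 1 *s u1 + p1 *s u0" "Ad u2 = s 2 *s u2 + p2 *s u1"
      and nz: "u0 \<noteq> 0" "u1 \<noteq> 0" "u2 \<noteq> 0" "E 2 u0 \<noteq> 0" "Es 2 u2 \<noteq> 0" "p1 \<noteq> 0" "p2 \<noteq> 0"
      and U1: "split_space 2 E Es 1 = span {u1}"
      and U2: "split_space 2 E Es 2 = span {u2}"
    by (rule split_basis)
  have th: "th i = t i" and ths: "ths i = s i" if "i \<le> 2" for i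
    using pa that P.eigenvalue_on_range[of i] Q.eigenvalue_on_range[of i]
    by (simp_all add: parameter_array_def)
  \<comment> \<open>\<open>Ad - s i\<close> sends \<open>u\<close> to \<open>p *s u'\<close> and the
    shift of \<open>A\<close> sends \<open>u'\<close> back to \<open>u\<close>, so the product acts
    as \<open>p\<close>; \<open>u \<noteq> 0\<close> makes this scalar unique.\<close>
  have ph_eq: "ph i = p"
    if i: "i \<in> {1..2}" and U: "split_space 2 E Es i = span {u}"
      and u: "u \<noteq> 0" and p: "p \<noteq> 0"
      and Ad_u: "Ad u = s i *s u + p *s u'" and A_u': "A u' = t (2 - i + 1) *s u' + u"
    for i p u u'
  proof -
    have "th (2 - i + 1) = t (2 - i + 1)" "ths i = s i"
      using i by (auto intro!: th ths)
    then have "ph i = (THE c. c \<noteq> 0 \<and> (\<forall>v\<in>split_space 2 E Es i.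
        (shift A (t (2 - i + 1)) \<circ> shift Ad (s i)) v = c *s v))"
      using pa[unfolded parameter_array_def, THEN conjunct2, THEN conjunct2, rule_format, OF i]
      by simp
    also have "\<dots> = p"
    proof -
      have act: "(shift A (t (2 - i + 1)) \<circ> shift Ad (s i)) (c *s u) = p *s c *s u" for c
        using Ad_u A_u'
        by (simp add: shift_def P.A.scale Q.A.scale P.A.add P.A.diff algebra_simps)
      show ?thesis
      proof (rule the_equality)
        show "p \<noteq> 0 \<and> (\<forall>v\<in>split_space 2 E Es i.
            (shift A (t (2 - i + 1)) \<circ> shift Ad (s i)) v = p *s v)"
          using p act by (auto simp: U span_singleton simp del: comp_apply)
      next
        fix c assume "c \<noteq> 0 \<and> (\<forall>v\<in>split_space 2 E Es i.
            (shift A (t (2 - i + 1)) \<circ> shift Ad (s i)) v = c *s v)"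
        moreover have "1 *s u \<in> split_space 2 E Es i" by (simp add: U span_base)
        ultimately have "p *s 1 *s u = c *s 1 *s u" using act[of 1] by metis
        then show "c = p" using u by simp
      qed
    qed
    finally show ?thesis .
  qed
  have ph: "ph 1 = p1" "ph 2 = p2"
    using ph_eq[of 1 u1 p1 u0] ph_eq[of 2 u2 p2 u1] U1 U2 nz A Ad by (simp_all add: numeral_2_eq_2)
  have v: "vth 1 = p1 - (s 1 - s 0) * (t 2 - t 0)" "vth 2 = p2 - (s 2 - s 0) * (t 1 - t 0)"
    using vth ph th ths by (simp_all add: numeral_2_eq_2)
  show ?E unfolding v
    by (rule P.corner_zero_iff[OF Q.A.linear_axioms A Ad nz(3,4)])
  \<comment> \<open>In the reversed, rescaled basis \<open>Ad\<close> has subdiagonal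
    \<open>1, 1\<close> and \<open>A\<close> has superdiagonal \<open>p2, p1\<close>. The swap of
    \<open>p1\<close> and \<open>p2\<close> yields the same equation with its sides
    exchanged.\<close>
  have "Es 0 \<circ> A \<circ> Es 2 = (\<lambda>_. 0) \<longleftrightarrow>
      p2 - (t 1 - t 0) * (s 2 - s 0) = p1 - (t 2 - t 0) * (s 1 - s 0)"
    by (rule Q.corner_zero_iff[of A u2 "p2 *s u1" "(p2 * p1) *s u0"])
      (use A Ad nz in \<open>simp_all add: P.A.linear_axioms P.A.scale Q.A.scale
        scale_right_distrib mult_ac\<close>)
  then show ?Es unfolding v by (auto simp: mult.commute)
qed

end

section \<open>Reduction of the tridiagonal condition to the two corners\<close>

theorem proposition12p8:
  fixes scale :: "'a::field \<Rightarrow> 'b::ab_group_add \<Rightarrow> 'b"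
    and d :: nat
    and A Ad :: "'b \<Rightarrow> 'b"
    and E Es :: "nat \<Rightarrow> 'b \<Rightarrow> 'b"
    and th ths ph vth :: "nat \<Rightarrow> 'a"
  assumes "vector_space scale"
    and "d = 2"
    and "vector_space.dim scale (UNIV :: 'b set) = d + 1"
    and "vector_space.Hessenberg_system scale d A E Ad Es"
    and "vector_space.parameter_array scale d A E Ad Es th ths ph"
    and "\<forall>i\<in>{1..d}. vth i = ph i - (ths i - ths 0) * (th (d - i + 1) - th 0)"
  shows "(E 0 \<circ> Ad \<circ> E 2 = (\<lambda>_. 0) \<longleftrightarrow> Es 0 \<circ> A \<circ> Es 2 = (\<lambda>_. 0)) \<and>
    (Es 0 \<circ> A \<circ> Es 2 = (\<lambda>_. 0) \<longleftrightarrow> vth 1 = vth 2) \<and>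
    (vth 1 = vth 2 \<longleftrightarrow> vector_space.tridiagonal_Hessenberg_system scale d A E Ad Es)"
proof -
  interpret vector_space scale by fact
  have H: "Hessenberg_system 2 A E Ad Es" using assms by simp
  have "multiplicity_free A" "primitive_idempotents 2 A E"
    and "multiplicity_free Ad" "primitive_idempotents 2 Ad Es"
    using H by (simp_all only: Hessenberg_system_def)
  then obtain t s where t: "spectral scale A 2 E t" and s: "spectral scale Ad 2 Es s"
    by (meson spectral_exists)
  have E: "\<forall>i\<le>2. \<forall>j\<le>2. (j + 1 < i \<longrightarrow> E i \<circ> Ad \<circ> E j = (\<lambda>_. 0)) \<and>
      (i = j + 1 \<longrightarrow> E i \<circ> Ad \<circ> E j \<noteq> (\<lambda>_. 0))"
    and Es: "\<forall>i\<le>2. \<forall>j\<le>2. (j + 1 < i \<longrightarrow> Es i \<circ> A \<circ> Es j = (\<lambda>_. 0)) \<and>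
      (i = j + 1 \<longrightarrow> Es i \<circ> A \<circ> Es j \<noteq> (\<lambda>_. 0))"
    using H unfolding Hessenberg_system_def by - (elim conjE, assumption)+
  interpret hessenberg3 scale A E t Ad Es s
    using vector_space_axioms t s E[rule_format, of 2 0] E[rule_format, of 1 0] E[rule_format, of 2 1]
      Es[rule_format, of 2 0] Es[rule_format, of 1 0] Es[rule_format, of 2 1]
    by (simp add: hessenberg3_def hessenberg3_axioms_def spectral3_def fun_eq_iff)
  have corner: "E 0 \<circ> Ad \<circ> E 2 = (\<lambda>_. 0) \<longleftrightarrow> vth 1 = vth 2"
    "Es 0 \<circ> A \<circ> Es 2 = (\<lambda>_. 0) \<longleftrightarrow> vth 1 = vth 2"
    using corners[of th ths ph vth] assms by simp_all
  \<comment> \<open>The only index pair above the superdiagonal is \<open>(0, 2)\<close>.\<close>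
  have "(\<forall>i\<le>2. \<forall>j\<le>2. i + 1 < j \<longrightarrow> P i j) \<longleftrightarrow> P 0 2" for P :: "nat \<Rightarrow> nat \<Rightarrow> bool"
  proof -
    have "i = 0 \<and> j = 2" if "i + 1 < j" "j \<le> 2" for i j :: nat using that by auto
    then show ?thesis by fastforce
  qed
  then have "tridiagonal_Hessenberg_system 2 A E Ad Es \<longleftrightarrow>
      E 0 \<circ> Ad \<circ> E 2 = (\<lambda>_. 0) \<and> Es 0 \<circ> A \<circ> Es 2 = (\<lambda>_. 0)"
    unfolding tridiagonal_Hessenberg_system_def by (simp only: H simp_thms)
  with corner show ?thesis using assms(2) by blast
qed

end
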